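(* Let $A,B$ be strictly positive operators on a complex Hilbert space. If $A\le B$, then $$T_{(1-t)a+tb}(A|B)\le(1-t)\,T_a(A|B)+t\,T_b(A|B)$$ for all $0<a,b\le 1$ and $0\le t\le 1$. If $B\le A$, then the reverse inequality $$T_{(1-t)a+tb}(A|B)\ge(1-t)\,T_a(A|B)+t\,T_b(A|B)$$ holds for all $0<a,b\le 1$ and $0\le t\le 1$.
   Context: An operator is strictly positive if it is positive and invertible (bounded linear); $\le$ is the usual order on self-adjoint operators. For strictly positive $A,B$ and $0<t\le 1$, the Tsallis relative operator entropy is $$T_t(A|B)=A^{1/2}\ln_t\left(A^{-1/2}BA^{-1/2}\right)A^{1/2}=\frac{A\sharp_tB-A}{t},$$ where $\ln_tx=\frac{x^t-1}{t}$ for $x>0$ and $A\sharp_tB=A^{1/2}(A^{-1/2}BA^{-1/2})^tA^{1/2}$. *)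

theory Defs
  imports "HOL-Analysis.Analysis" "HOL-Computational_Algebra.Polynomial"
begin

section \<open>Complex Hilbert spaces\<close>

class complex_vector = real_vector +
  fixes scaleC :: "complex \<Rightarrow> 'a \<Rightarrow> 'a" (infixr "*\<^sub>C" 75)
  assumes scaleC_add_right: "z *\<^sub>C (x + y) = z *\<^sub>C x + z *\<^sub>C y"
    and scaleC_add_left: "(z + w) *\<^sub>C x = z *\<^sub>C x + w *\<^sub>C x"
    and scaleC_scaleC: "z *\<^sub>C w *\<^sub>C x = (z * w) *\<^sub>C x"
    and scaleC_one: "1 *\<^sub>C x = x"
    and scaleR_scaleC: "r *\<^sub>R x = complex_of_real r *\<^sub>C x"

text \<open>The inner product is linear in the first argument and conjugate-linear in the second.\<close>

class complex_inner = complex_vector + real_normed_vector +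
  fixes cinner :: "'a \<Rightarrow> 'a \<Rightarrow> complex"
  assumes cinner_commute: "cinner x y = cnj (cinner y x)"
    and cinner_add_left: "cinner (x + y) z = cinner x z + cinner y z"
    and cinner_scaleC_left: "cinner (c *\<^sub>C x) y = c * cinner x y"
    and cinner_ge_zero: "cinner x x \<in> \<real>\<^sub>\<ge>\<^sub>0"
    and cinner_eq_zero_iff: "cinner x x = 0 \<longleftrightarrow> x = 0"
    and norm_eq_sqrt_cinner: "norm x = sqrt (Re (cinner x x))"

class chilbert_space = complex_inner + complete_space

lemma norm_scaleC: "norm (c *\<^sub>C (x::'a::complex_inner)) = cmod c * norm x"
proof -
  have r: "cinner x (c *\<^sub>C x) = cnj c * cinner x x"
    by (metis cinner_commute cinner_scaleC_left complex_cnj_mult)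
  have "cinner (c *\<^sub>C x) (c *\<^sub>C x) = (c * cnj c) * cinner x x"
    by (simp add: cinner_scaleC_left r)
  also have "\<dots> = complex_of_real ((cmod c)\<^sup>2) * cinner x x"
    by (simp only: complex_norm_square)
  finally have "Re (cinner (c *\<^sub>C x) (c *\<^sub>C x)) = (cmod c)\<^sup>2 * Re (cinner x x)"
    by simp
  then show ?thesis
    by (simp add: norm_eq_sqrt_cinner real_sqrt_mult)
qed

lemma bounded_linear_scaleC: "bounded_linear (\<lambda>x::'a::complex_inner. c *\<^sub>C x)"
  by (rule bounded_linear_intro[where K = "cmod c"])
    (simp_all add: scaleC_add_right scaleR_scaleC scaleC_scaleC norm_scaleC mult.commute)

section \<open>Bounded operators\<close>

text \<open>The type \<open>'a \<Rightarrow>\<^sub>L 'a\<close> consists of the real-linear bounded operators; the complex-linear ones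
  are singled out by a predicate. The operator norm is the same in both settings.\<close>

definition complex_linear_op :: "('a::complex_inner \<Rightarrow>\<^sub>L 'a) \<Rightarrow> bool" where
  "complex_linear_op A \<longleftrightarrow> (\<forall>c x. blinfun_apply A (c *\<^sub>C x) = c *\<^sub>C blinfun_apply A x)"

lift_definition scalar_op :: "complex \<Rightarrow> 'a::complex_inner \<Rightarrow>\<^sub>L 'a" is "\<lambda>c x. c *\<^sub>C x"
  by (rule bounded_linear_scaleC)

definition invertible_op :: "('a::complex_inner \<Rightarrow>\<^sub>L 'a) \<Rightarrow> bool" where
  "invertible_op A \<longleftrightarrow>
    (\<exists>B. complex_linear_op B \<and> A o\<^sub>L B = id_blinfun \<and> B o\<^sub>L A = id_blinfun)"

definition spectrum_op :: "('a::complex_inner \<Rightarrow>\<^sub>L 'a) \<Rightarrow> complex set" where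
  "spectrum_op A = {z. \<not> invertible_op (A - scalar_op z)}"

definition selfadjoint_op :: "('a::complex_inner \<Rightarrow>\<^sub>L 'a) \<Rightarrow> bool" where
  "selfadjoint_op A \<longleftrightarrow> complex_linear_op A \<and>
    (\<forall>x y. cinner (blinfun_apply A x) y = cinner x (blinfun_apply A y))"

definition positive_op :: "('a::complex_inner \<Rightarrow>\<^sub>L 'a) \<Rightarrow> bool" where
  "positive_op A \<longleftrightarrow> complex_linear_op A \<and> (\<forall>x. cinner (blinfun_apply A x) x \<in> \<real>\<^sub>\<ge>\<^sub>0)"

definition strictly_positive_op :: "('a::complex_inner \<Rightarrow>\<^sub>L 'a) \<Rightarrow> bool" where
  "strictly_positive_op A \<longleftrightarrow> positive_op A \<and> invertible_op A"

definition le_op :: "('a::complex_inner \<Rightarrow>\<^sub>L 'a) \<Rightarrow> ('a \<Rightarrow>\<^sub>L 'a) \<Rightarrow> bool" (infix "\<le>\<^sub>o\<^sub>p" 50) where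
  "A \<le>\<^sub>o\<^sub>p B \<longleftrightarrow> selfadjoint_op A \<and> selfadjoint_op B \<and> positive_op (B - A)"

section \<open>Continuous functional calculus\<close>

definition poly_op :: "real poly \<Rightarrow> ('a::complex_inner \<Rightarrow>\<^sub>L 'a) \<Rightarrow> ('a \<Rightarrow>\<^sub>L 'a)" where
  "poly_op p A = (\<Sum>i\<le>degree p. coeff p i *\<^sub>R ((\<lambda>X. A o\<^sub>L X) ^^ i) id_blinfun)"

text \<open>\<open>cfc f A\<close> is the operator \<open>f(A)\<close> for self-adjoint \<open>A\<close> and a real function \<open>f\<close> continuous on
  the spectrum of \<open>A\<close>: the common operator-norm limit of \<open>p\<^sub>n(A)\<close> over all sequences of polynomials
  \<open>p\<^sub>n\<close> converging to \<open>f\<close> uniformly on the spectrum. As the spectrum of a self-adjoint operator is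
  real, nothing is lost by ranging over its real points. Outside this setting the value is
  meaningless.\<close>

definition cfc :: "(real \<Rightarrow> real) \<Rightarrow> ('a::chilbert_space \<Rightarrow>\<^sub>L 'a) \<Rightarrow> ('a \<Rightarrow>\<^sub>L 'a)" where
  "cfc f A = (THE T. \<forall>p. uniform_limit {x. complex_of_real x \<in> spectrum_op A}
                            (\<lambda>n. poly (p n)) f sequentially
                        \<longrightarrow> (\<lambda>n. poly_op (p n) A) \<longlonglongrightarrow> T)"

definition powr_op :: "('a::chilbert_space \<Rightarrow>\<^sub>L 'a) \<Rightarrow> real \<Rightarrow> ('a \<Rightarrow>\<^sub>L 'a)" where
  "powr_op A s = cfc (\<lambda>x. x powr s) A"

section \<open>Tsallis relative operator entropy\<close>

definition tsallis_ln :: "real \<Rightarrow> real \<Rightarrow> real" where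
  "tsallis_ln t x = (x powr t - 1) / t"

definition tsallis_entropy ::
    "real \<Rightarrow> ('a::chilbert_space \<Rightarrow>\<^sub>L 'a) \<Rightarrow> ('a \<Rightarrow>\<^sub>L 'a) \<Rightarrow> ('a \<Rightarrow>\<^sub>L 'a)" where
  "tsallis_entropy t A B =
     powr_op A (1/2) o\<^sub>L
     cfc (tsallis_ln t) (powr_op A (-1/2) o\<^sub>L B o\<^sub>L powr_op A (-1/2)) o\<^sub>L
     powr_op A (1/2)"

end

theory Submission
  imports Defs "HOL-Computational_Algebra.Fundamental_Theorem_Algebra"
begin

text \<open>For fixed \<open>x > 0\<close> the function \<open>t \<mapsto> ln\<^sub>t x\<close> is convex on \<open>t > 0\<close> if \<open>x \<ge> 1\<close> and concave if
  \<open>x \<le> 1\<close>: with \<open>u = t ln x\<close> its second derivative is \<open>(exp u (u\<^sup>2 - 2 u + 2) - 2) / t\<^sup>3\<close>, whose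
  numerator increases in \<open>u\<close> and vanishes at \<open>u = 0\<close>. If \<open>A \<le> B\<close>, the spectrum of
  \<open>X = A\<^sup>-\<^sup>1\<^sup>/\<^sup>2 B A\<^sup>-\<^sup>1\<^sup>/\<^sup>2\<close> lies in \<open>[1, \<infinity>)\<close>, and if \<open>B \<le> A\<close> it lies in \<open>(0, 1]\<close>; so the scalar inequality
  carries over to \<open>X\<close> by the functional calculus and to the entropies by conjugation with
  \<open>A\<^sup>1\<^sup>/\<^sup>2\<close>.

  The functional calculus rests on the fact that a polynomial which is nonnegative on the spectrum
  of a self-adjoint \<open>A\<close> gives a positive operator; applied to \<open>c\<^sup>2 - p\<^sup>2\<close>, this bounds the norm of
  \<open>p(A)\<close> by the supremum of \<open>|p|\<close> on the spectrum.\<close>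

text \<open>Completeness of the underlying space makes the space of bounded operators complete, so
  Cauchy sequences of operators converge.\<close>

instance chilbert_space \<subseteq> banach ..

section \<open>The real part of the inner product\<close>

text \<open>Bounded operators are only real-linear by type, so a real bilinear form fits them best.
  No information is lost: imaginary parts are real parts after multiplication by
  \<open>- \<i>\<close>.\<close>

definition rip :: "'a::complex_inner \<Rightarrow> 'a \<Rightarrow> real" where
  "rip x y = Re (cinner x y)"

lemma rip_commute: "rip x y = rip y x"
  unfolding rip_def by (subst cinner_commute) simp

lemma rip_add_left: "rip (x + y) z = rip x z + rip y z"
  by (simp add: rip_def cinner_add_left)

lemma rip_scaleR_left: "rip (r *\<^sub>R x) y = r * rip x y"
  by (simp add: rip_def scaleR_scaleC cinner_scaleC_left)

lemma rip_self: "rip x x = (norm x)\<^sup>2"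
  using cinner_ge_zero[of x]
  by (simp add: rip_def norm_eq_sqrt_cinner complex_nonneg_Reals_iff)

lemma Im_cinner: "Im (cinner x y) = rip ((- \<i>) *\<^sub>C x) y"
  by (simp only: rip_def cinner_scaleC_left) simp

text \<open>For \<open>c > 0\<close> evaluate at the minimiser \<open>t = b / c\<close>; for
  \<open>c = 0\<close> an affine function bounded below is constant. This is the common core of the
  two Cauchy-Schwarz arguments below.\<close>

lemma nonneg_quadratic_imp_discriminant:
  fixes a b c :: real
  assumes "0 \<le> c" "\<And>t. 0 \<le> a - 2 * t * b + t\<^sup>2 * c"
  shows "b\<^sup>2 \<le> a * c"
proof (cases "c = 0")
  case True
  have "b = 0"
  proof (rule ccontr)
    assume "b \<noteq> 0"
    then show False
      \<comment> \<open>At this \<open>t\<close> the affine expression equals -1.\<close>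
      using assms(2)[of "(a + 1) / (2 * b)"] True by simp
  qed
  then show ?thesis using True by simp
next
  case False
  from False \<open>0 \<le> c\<close> have "c > 0" by simp
  then show ?thesis
    using assms(2)[of "b / c"] by (simp add: field_simps power2_eq_square)
qed

lemma rip_diff_left: "rip (x - y) z = rip x z - rip y z"
  using rip_add_left[of "x - y" y z] by simp

lemma rip_add_right: "rip x (y + z) = rip x y + rip x z"
  and rip_diff_right: "rip x (y - z) = rip x y - rip x z"
  and rip_scaleR_right: "rip x (r *\<^sub>R y) = r * rip x y"
  by (simp_all add: rip_commute[of x] rip_add_left rip_diff_left rip_scaleR_left)

lemma abs_rip_le: "\<bar>rip x y\<bar> \<le> norm x * norm y"
proof -
  have "(rip x y)\<^sup>2 \<le> rip x x * rip y y"
  proof (rule nonneg_quadratic_imp_discriminant)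
    fix t
    have "0 \<le> rip (x - t *\<^sub>R y) (x - t *\<^sub>R y)" by (simp add: rip_self)
    also have "\<dots> = rip x x - 2 * t * rip x y + t\<^sup>2 * rip y y"
      by (simp add: rip_diff_left rip_diff_right rip_scaleR_left rip_scaleR_right
          rip_commute[of y x] power2_eq_square algebra_simps)
    finally show "0 \<le> rip x x - 2 * t * rip x y + t\<^sup>2 * rip y y" .
  qed (simp add: rip_self)
  then have "(rip x y)\<^sup>2 \<le> (norm x * norm y)\<^sup>2" by (simp add: rip_self power_mult_distrib)
  then show ?thesis by (metis abs_le_square_iff abs_mult abs_norm_cancel)
qed

interpretation rip: bounded_bilinear rip
  by unfold_locales
    (auto simp: rip_add_left rip_add_right rip_scaleR_left rip_scaleR_right
      intro!: exI[of _ 1] abs_rip_le)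

section \<open>Self-adjoint operators\<close>

lemma scalar_op_of_real: "scalar_op (complex_of_real r) = r *\<^sub>R id_blinfun"
  by (rule blinfun_eqI) (simp add: scalar_op.rep_eq scaleR_blinfun.rep_eq scaleR_scaleC)

lemma complex_linear_id: "complex_linear_op id_blinfun"
  by (simp add: complex_linear_op_def)

lemma complex_linear_compose:
  "complex_linear_op A \<Longrightarrow> complex_linear_op B \<Longrightarrow> complex_linear_op (A o\<^sub>L B)"
  by (simp add: complex_linear_op_def)

lemma complex_linear_add:
  "complex_linear_op A \<Longrightarrow> complex_linear_op B \<Longrightarrow> complex_linear_op (A + B)"
  by (simp add: complex_linear_op_def blinfun.add_left scaleC_add_right)

lemma complex_linear_scaleR: "complex_linear_op A \<Longrightarrow> complex_linear_op (r *\<^sub>R A)"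
  by (simp add: complex_linear_op_def blinfun.scaleR_left scaleR_scaleC scaleC_scaleC mult.commute)

text \<open>A complex-linear operator commutes with multiplication by \<open>- \<i>\<close>, so
  symmetry of the real part forces symmetry of the imaginary part.\<close>

lemma selfadjoint_opI:
  assumes "complex_linear_op A" "\<And>x y. rip (A x) y = rip x (A y)"
  shows "selfadjoint_op A"
proof -
  have "Im (cinner (A x) y) = Im (cinner x (A y))" for x y
    using assms(1) by (simp only: Im_cinner complex_linear_op_def flip: assms(2))
  then show ?thesis
    using assms by (auto simp: selfadjoint_op_def rip_def complex_eq_iff)
qed

lemma selfadjoint_rip: "selfadjoint_op A \<Longrightarrow> rip (A x) y = rip x (A y)"
  by (simp add: selfadjoint_op_def rip_def)

lemma selfadjoint_complex_linear: "selfadjoint_op A \<Longrightarrow> complex_linear_op A"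
  by (simp add: selfadjoint_op_def)

lemma selfadjoint_id: "selfadjoint_op id_blinfun"
  by (simp add: selfadjoint_op_def complex_linear_id)

lemma selfadjoint_add: "selfadjoint_op A \<Longrightarrow> selfadjoint_op B \<Longrightarrow> selfadjoint_op (A + B)"
  by (rule selfadjoint_opI)
    (simp_all add: selfadjoint_complex_linear complex_linear_add blinfun.add_left
      rip_add_left rip_add_right selfadjoint_rip)

lemma selfadjoint_scaleR: "selfadjoint_op A \<Longrightarrow> selfadjoint_op (r *\<^sub>R A)"
  by (rule selfadjoint_opI)
    (simp_all add: selfadjoint_complex_linear complex_linear_scaleR blinfun.scaleR_left
      rip_scaleR_left rip_scaleR_right selfadjoint_rip)

lemma selfadjoint_diff: "selfadjoint_op A \<Longrightarrow> selfadjoint_op B \<Longrightarrow> selfadjoint_op (A - B)"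
  using selfadjoint_add[of A "(- 1) *\<^sub>R B"] selfadjoint_scaleR[of B "- 1"] by simp

lemma selfadjoint_compose:
  assumes "selfadjoint_op A" "selfadjoint_op B" "A o\<^sub>L B = B o\<^sub>L A"
  shows "selfadjoint_op (A o\<^sub>L B)"
proof (rule selfadjoint_opI)
  show "complex_linear_op (A o\<^sub>L B)"
    using assms by (simp add: selfadjoint_complex_linear complex_linear_compose)
  show "rip ((A o\<^sub>L B) x) y = rip x ((A o\<^sub>L B) y)" for x y
    using arg_cong[OF assms(3), of "\<lambda>R. blinfun_apply R y"] by (simp add: selfadjoint_rip assms(1,2))
qed

lemma selfadjoint_conjugate:
  assumes "selfadjoint_op R" "selfadjoint_op F"
  shows "selfadjoint_op (R o\<^sub>L F o\<^sub>L R)"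
  by (rule selfadjoint_opI)
    (use assms in \<open>simp_all add: selfadjoint_complex_linear complex_linear_compose selfadjoint_rip\<close>)

text \<open>Norm convergence implies pointwise convergence, and both complex linearity and symmetry
  are equations preserved by pointwise limits.\<close>

lemma selfadjoint_limit:
  assumes "\<And>n. selfadjoint_op (S n)" "S \<longlonglongrightarrow> T"
  shows "selfadjoint_op T"
proof (rule selfadjoint_opI)
  have lim: "(\<lambda>n. S n x) \<longlonglongrightarrow> T x" for x
    by (intro blinfun.tendsto assms(2) tendsto_const)
  have "T (c *\<^sub>C x) = c *\<^sub>C T x" for c x
  proof (rule LIMSEQ_unique)
    show "(\<lambda>n. S n (c *\<^sub>C x)) \<longlonglongrightarrow> T (c *\<^sub>C x)" by (rule lim)
    have "S n (c *\<^sub>C x) = c *\<^sub>C S n x" for n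
      using assms(1)[of n] by (simp add: selfadjoint_op_def complex_linear_op_def)
    then show "(\<lambda>n. S n (c *\<^sub>C x)) \<longlonglongrightarrow> c *\<^sub>C T x"
      using bounded_linear.tendsto[OF bounded_linear_scaleC lim[of x]] by simp
  qed
  then show "complex_linear_op T" by (simp add: complex_linear_op_def)
  show "rip (T x) y = rip x (T y)" for x y
  proof (rule LIMSEQ_unique)
    show "(\<lambda>n. rip (S n x) y) \<longlonglongrightarrow> rip (T x) y"
      by (intro rip.tendsto lim tendsto_const)
    show "(\<lambda>n. rip (S n x) y) \<longlonglongrightarrow> rip x (T y)"
      unfolding selfadjoint_rip[OF assms(1)] by (intro rip.tendsto lim tendsto_const)
  qed
qed

text \<open>The diagonal values of a self-adjoint form are real, so positivity can be read off the
  real part.\<close>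

lemma positive_op_iff:
  assumes "selfadjoint_op A"
  shows "positive_op A \<longleftrightarrow> (\<forall>x. 0 \<le> rip (A x) x)"
proof -
  have "Im (cinner (A x) x) = 0" for x
  proof -
    have "cinner (A x) x = cnj (cinner (A x) x)"
      using assms cinner_commute[of x "A x"] by (simp add: selfadjoint_op_def)
    then show ?thesis by (metis cnj.simps(2) neg_equal_zero)
  qed
  then show ?thesis
    using assms by (auto simp: positive_op_def selfadjoint_op_def complex_nonneg_Reals_iff rip_def)
qed

text \<open>Cauchy-Schwarz for the semi-inner product \<open>rip (P u) v\<close> at
  \<open>u = x\<close> and \<open>v = P x\<close> bounds the fourth power of
  \<open>norm (P x)\<close> by \<open>rip (P x) x * norm P * (norm (P x))\<^sup>2\<close>; then
  cancel the last factor.\<close>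

lemma positive_op_norm_le:
  assumes "selfadjoint_op P" "\<And>x. 0 \<le> rip (P x) x"
  shows "(norm (P x))\<^sup>2 \<le> norm P * rip (P x) x"
proof -
  let ?y = "P x"
  have "(rip (P x) ?y)\<^sup>2 \<le> rip (P x) x * rip (P ?y) ?y"
  proof (rule nonneg_quadratic_imp_discriminant)
    fix t
    have "0 \<le> rip (P (x - t *\<^sub>R ?y)) (x - t *\<^sub>R ?y)" by (rule assms)
    also have "\<dots> = rip (P x) x - 2 * t * rip (P x) ?y + t\<^sup>2 * rip (P ?y) ?y"
      using selfadjoint_rip[OF assms(1), of ?y x]
      by (simp add: blinfun.diff_right blinfun.scaleR_right rip_diff_left rip_diff_right
          rip_scaleR_left rip_scaleR_right rip_commute[of x] power2_eq_square algebra_simps)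
    finally show "0 \<le> rip (P x) x - 2 * t * rip (P x) ?y + t\<^sup>2 * rip (P ?y) ?y" .
  qed (rule assms)
  also have "rip (P ?y) ?y \<le> norm P * (norm ?y)\<^sup>2"
    using abs_rip_le[of "P ?y" ?y] norm_blinfun[of P ?y]
      mult_right_mono[OF norm_blinfun[of P ?y], of "norm ?y"]
    by (simp add: power2_eq_square mult.assoc)
  finally have *: "((norm ?y)\<^sup>2)\<^sup>2 \<le> rip (P x) x * (norm P * (norm ?y)\<^sup>2)"
    using assms(2)[of x] by (simp add: rip_self mult_left_mono)
  show ?thesis
  proof (cases "?y = 0")
    case True
    then show ?thesis by (simp add: rip.zero_left)
  next
    case False
    then have "0 < (norm ?y)\<^sup>2" by simp
    moreover have "(norm ?y)\<^sup>2 * (norm ?y)\<^sup>2 \<le> (norm P * rip (P x) x) * (norm ?y)\<^sup>2"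
      using * by (simp add: power2_eq_square mult_ac)
    ultimately show ?thesis by (simp only: mult_le_cancel_right)
  qed
qed

section \<open>Invertibility\<close>

text \<open>For self-adjoint operators this turns out to be equivalent to invertibility. It is
  easier to handle, since it is a plain norm estimate and passes to products.\<close>

definition bounded_below_op :: "('a::complex_inner \<Rightarrow>\<^sub>L 'a) \<Rightarrow> bool" where
  "bounded_below_op S \<longleftrightarrow> (\<exists>c>0. \<forall>x. c * norm x \<le> norm (S x))"

lemma bounded_below_compose:
  assumes "bounded_below_op S" "bounded_below_op T"
  shows "bounded_below_op (S o\<^sub>L T)"
proof -
  obtain c d where c: "c > 0" "\<And>x. c * norm x \<le> norm (S x)"
    and d: "d > 0" "\<And>x. d * norm x \<le> norm (T x)"
    using assms unfolding bounded_below_op_def by blast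
  have "(c * d) * norm x \<le> norm ((S o\<^sub>L T) x)" for x
    using order_trans[OF mult_left_mono[OF d(2)[of x], of c] c(2)[of "T x"]] c(1)
    by (simp add: mult.assoc)
  then show ?thesis
    unfolding bounded_below_op_def using c(1) d(1) by (intro exI[of _ "c * d"]) simp
qed

lemma coercive_imp_bounded_below:
  fixes S :: "'a::complex_inner \<Rightarrow>\<^sub>L 'a"
  assumes "\<delta> > 0" "\<And>x. \<delta> * (norm x)\<^sup>2 \<le> rip (S x) x"
  shows "bounded_below_op S"
  unfolding bounded_below_op_def
proof (intro exI[of _ \<delta>] conjI allI)
  fix x
  have "\<delta> * norm x * norm x \<le> norm (S x) * norm x"
    using assms(2)[of x] abs_rip_le[of "S x" x] by (simp add: power2_eq_square mult.assoc)
  then show "\<delta> * norm x \<le> norm (S x)"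
    by (cases "x = 0") (simp_all add: mult_le_cancel_right)
qed (rule assms(1))

lemma invertible_imp_bounded_below:
  assumes "invertible_op S"
  shows "bounded_below_op S"
proof -
  obtain T where T: "T o\<^sub>L S = id_blinfun"
    using assms unfolding invertible_op_def by blast
  show ?thesis
    unfolding bounded_below_op_def
  \<comment> \<open>Adding 1 keeps the denominator positive even when the space is trivial and
    \<open>T = 0\<close>.\<close>
  proof (intro exI[of _ "inverse (norm T + 1)"] conjI allI)
    fix x
    have "x = T (S x)" by (metis T blinfun_apply_blinfun_compose blinfun_apply_id_blinfun id_apply)
    then have "norm x \<le> norm T * norm (S x)" by (metis norm_blinfun)
    also have "\<dots> \<le> (norm T + 1) * norm (S x)" by (simp add: mult_right_mono)
    finally have "norm x / (norm T + 1) \<le> norm (S x)"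
      using add_nonneg_pos[OF norm_ge_zero[of T] zero_less_one] by (simp add: pos_divide_le_eq mult.commute)
    then show "inverse (norm T + 1) * norm x \<le> norm (S x)"
      by (simp add: divide_inverse mult.commute)
  qed (simp add: add_nonneg_pos)
qed

text \<open>The lower bound \<open>c\<close> gives injectivity, hence a set-theoretic inverse.
  Injectivity transfers linearity to the inverse, and the bound gives it norm at most
  \<open>1 / c\<close>.\<close>

lemma surj_bounded_below_imp_invertible:
  assumes "complex_linear_op S" "surj (blinfun_apply S)" "bounded_below_op S"
  shows "invertible_op S"
proof -
  obtain c where c: "c > 0" "\<And>x. c * norm x \<le> norm (S x)"
    using assms(3) unfolding bounded_below_op_def by blast
  have inj: "x = y" if "S x = S y" for x y
    using c(2)[of "x - y"] c(1) that
    by (simp add: blinfun.diff_right mult_le_0_iff)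
  define g where "g = inv (blinfun_apply S)"
  have Sg: "S (g y) = y" for y unfolding g_def by (rule surj_f_inv_f[OF assms(2)])
  have gS: "g (S x) = x" for x by (rule inj) (simp add: Sg)
  have "bounded_linear g"
  proof (rule bounded_linear_intro[where K = "1 / c"])
    show "g (x + y) = g x + g y" for x y by (rule inj) (simp add: Sg blinfun.add_right)
    show "g (r *\<^sub>R x) = r *\<^sub>R g x" for r x by (rule inj) (simp add: Sg blinfun.scaleR_right)
    show "norm (g x) \<le> norm x * (1 / c)" for x
      using c(2)[of "g x"] c(1) by (simp add: Sg field_simps)
  qed
  then have G: "blinfun_apply (Blinfun g) = g" by (rule bounded_linear_Blinfun_apply)
  have "g (z *\<^sub>C x) = z *\<^sub>C g x" for z x
    by (rule inj) (use assms(1) in \<open>simp add: Sg complex_linear_op_def\<close>)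
  then show ?thesis
    unfolding invertible_op_def
    by (intro exI[of _ "Blinfun g"]) (auto simp: complex_linear_op_def G Sg gS intro!: blinfun_eqI)
qed

text \<open>Solving \<open>S x = y\<close> for coercive \<open>S\<close> (Lax--Milgram): for small \<open>\<tau>\<close>,
  \<open>x \<mapsto> x - \<tau> (S x - y)\<close> is a contraction.\<close>

lemma coercive_imp_invertible:
  fixes S :: "'a::chilbert_space \<Rightarrow>\<^sub>L 'a"
  assumes lin: "complex_linear_op S" and "\<delta> > 0" and co: "\<And>x. \<delta> * (norm x)\<^sup>2 \<le> rip (S x) x"
  shows "invertible_op S"
proof (rule surj_bounded_below_imp_invertible[OF lin])
  show "bounded_below_op S" using assms(2) co by (rule coercive_imp_bounded_below)
  \<comment> \<open>\<open>M\<close> dominates \<open>(norm S)\<^sup>2\<close> and exceeds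
    \<open>\<delta>\<^sup>2\<close>. With \<tau> = \<delta> / M, the contraction factor satisfies
    \<open>q\<^sup>2 = 1 - 2 * \<tau> * \<delta> + \<tau>\<^sup>2 * M = 1 - \<delta>\<^sup>2 /
    M\<close>, which lies strictly between 0 and 1.\<close>
  define M where "M = (norm S)\<^sup>2 + \<delta>\<^sup>2 + 1"
  define \<tau> where "\<tau> = \<delta> / M"
  define q where "q = sqrt (1 - \<delta>\<^sup>2 / M)"
  have "M > 0" and "\<delta>\<^sup>2 < M"
    unfolding M_def by (simp_all add: add_nonneg_pos)
  then have frac: "0 < \<delta>\<^sup>2 / M" "\<delta>\<^sup>2 / M < 1" using \<open>\<delta> > 0\<close> by simp_all
  then have q: "0 \<le> q" "q < 1" "q\<^sup>2 = 1 - \<delta>\<^sup>2 / M" unfolding q_def by simp_all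
  have "\<tau> \<ge> 0" unfolding \<tau>_def using \<open>\<delta> > 0\<close> \<open>M > 0\<close> by simp
  have contr: "norm (x - \<tau> *\<^sub>R S x) \<le> q * norm x" for x
  proof -
    have "(norm (S x))\<^sup>2 \<le> (norm S * norm x)\<^sup>2"
      using norm_blinfun by (intro power_mono) auto
    also have "\<dots> \<le> M * (norm x)\<^sup>2"
      unfolding M_def power_mult_distrib by (intro mult_right_mono) auto
    finally have SM: "(norm (S x))\<^sup>2 \<le> M * (norm x)\<^sup>2" .
    have "(norm (x - \<tau> *\<^sub>R S x))\<^sup>2 = (norm x)\<^sup>2 - 2 * \<tau> * rip (S x) x + \<tau>\<^sup>2 * (norm (S x))\<^sup>2"
      unfolding rip_self[symmetric]
      by (simp add: rip_diff_left rip_diff_right rip_scaleR_left rip_scaleR_right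
          rip_commute[of x "S x"] power2_eq_square algebra_simps)
    also have "\<dots> \<le> (norm x)\<^sup>2 - 2 * \<tau> * (\<delta> * (norm x)\<^sup>2) + \<tau>\<^sup>2 * (M * (norm x)\<^sup>2)"
      by (intro add_mono diff_mono mult_left_mono SM co) (use \<open>\<tau> \<ge> 0\<close> in auto)
    also have "\<dots> = q\<^sup>2 * (norm x)\<^sup>2"
      unfolding q(3) \<tau>_def using \<open>M > 0\<close> by (simp add: field_simps power2_eq_square)
    finally have "(norm (x - \<tau> *\<^sub>R S x))\<^sup>2 \<le> (q * norm x)\<^sup>2" by (simp add: power_mult_distrib)
    then show ?thesis by (rule power2_le_imp_le) (simp add: q)
  qed
  show "surj (blinfun_apply S)"
  unfolding surj_def
  proof
    fix y
    define f where "f x = x - \<tau> *\<^sub>R (S x - y)" for x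
    have "dist (f x) (f z) \<le> q * dist x z" for x z
    proof -
      have "f x - f z = (x - z) - \<tau> *\<^sub>R S (x - z)"
        by (simp add: f_def blinfun.diff_right algebra_simps)
      then show ?thesis using contr[of "x - z"] by (simp add: dist_norm)
    qed
    then have "\<exists>!x. f x = x"
      using q by (intro banach_fix_type[of q]) auto
    then obtain x where "f x = x" by blast
    then have "S x = y" using \<open>\<delta> > 0\<close> \<open>M > 0\<close> by (simp add: f_def \<tau>_def)
    then show "\<exists>x. y = S x" by blast
  qed
qed

text \<open>By symmetry the form of \<open>S o\<^sub>L S\<close> at \<open>x\<close> is
  \<open>(norm (S x))\<^sup>2\<close>, so the square is coercive and hence invertible. A right
  inverse of the square makes \<open>S\<close> surjective.\<close>

lemma selfadjoint_bounded_below_imp_invertible: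
  fixes S :: "'a::chilbert_space \<Rightarrow>\<^sub>L 'a"
  assumes sa: "selfadjoint_op S" and bb: "bounded_below_op S"
  shows "invertible_op S"
proof -
  obtain c where c: "c > 0" "\<And>x. c * norm x \<le> norm (S x)"
    using bb unfolding bounded_below_op_def by blast
  have "invertible_op (S o\<^sub>L S)"
  proof (rule coercive_imp_invertible)
    show "complex_linear_op (S o\<^sub>L S)"
      using sa by (simp add: selfadjoint_complex_linear complex_linear_compose)
    show "c\<^sup>2 > 0" using c by simp
    show "c\<^sup>2 * (norm x)\<^sup>2 \<le> rip ((S o\<^sub>L S) x) x" for x
      using power_mono[OF c(2)[of x], of 2] c(1)
      by (simp add: selfadjoint_rip[OF sa] rip_self power_mult_distrib)
  qed
  then obtain T where T: "(S o\<^sub>L S) o\<^sub>L T = id_blinfun"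
    unfolding invertible_op_def by blast
  show ?thesis
  proof (rule surj_bounded_below_imp_invertible[OF _ _ bb])
    show "complex_linear_op S" using sa by (rule selfadjoint_complex_linear)
    show "surj (blinfun_apply S)"
    proof (rule surjI)
      show "S (S (T y)) = y" for y
        using arg_cong[OF T, of "\<lambda>R. blinfun_apply R y"] by simp
    qed
  qed
qed

text \<open>Chain the lower bound \<open>c\<close> with \<open>positive_op_norm_le\<close>:
  \<open>c\<^sup>2 * (norm x)\<^sup>2\<close> is at most \<open>(norm (P x))\<^sup>2\<close>, hence
  at most \<open>norm P * rip (P x) x\<close>.\<close>

lemma positive_bounded_below_imp_coercive:
  assumes sa: "selfadjoint_op P" and pos: "\<And>x. 0 \<le> rip (P x) x" and bb: "bounded_below_op P"
  obtains \<delta> where "\<delta> > 0" "\<And>x. \<delta> * (norm x)\<^sup>2 \<le> rip (P x) x"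
proof -
  obtain c where c: "c > 0" "\<And>x. c * norm x \<le> norm (P x)"
    using bb unfolding bounded_below_op_def by blast
  have "c\<^sup>2 / (norm P + 1) * (norm x)\<^sup>2 \<le> rip (P x) x" for x
  proof -
    have "c\<^sup>2 * (norm x)\<^sup>2 \<le> (norm (P x))\<^sup>2"
      using power_mono[OF c(2)[of x], of 2] c(1) by (simp add: power_mult_distrib)
    also have "\<dots> \<le> norm P * rip (P x) x" by (rule positive_op_norm_le[OF sa pos])
    also have "\<dots> \<le> (norm P + 1) * rip (P x) x" using pos[of x] by (simp add: mult_right_mono)
    finally show ?thesis
      using add_nonneg_pos[OF norm_ge_zero[of P] zero_less_one]
      by (simp add: pos_divide_le_eq mult.commute)
  qed
  moreover have "c\<^sup>2 / (norm P + 1) > 0"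
    using c(1) by (intro divide_pos_pos add_nonneg_pos) auto
  ultimately show ?thesis by (rule that[rotated])
qed

section \<open>Polynomials of an operator\<close>

interpretation blinfun_compose: bounded_bilinear "(o\<^sub>L)"
  by (rule bounded_bilinear_blinfun_compose)

text \<open>Padding with zero coefficients brings polynomials of different degrees to one summation
  range.\<close>

lemma poly_op_eq_sum:
  assumes "degree p \<le> n"
  shows "poly_op p A = (\<Sum>i\<le>n. coeff p i *\<^sub>R ((\<lambda>X. A o\<^sub>L X) ^^ i) id_blinfun)"
  unfolding poly_op_def
  by (rule sum.mono_neutral_left) (use assms in \<open>auto simp: coeff_eq_0\<close>)

lemma poly_op_0 [simp]: "poly_op 0 A = 0"
  by (simp add: poly_op_def)

lemma poly_op_add: "poly_op (p + q) A = poly_op p A + poly_op q A"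
proof -
  let ?n = "max (degree p) (degree q)"
  have "degree (p + q) \<le> ?n" by (rule degree_add_le_max)
  then show ?thesis
    by (simp add: poly_op_eq_sum[of _ ?n] scaleR_add_left sum.distrib)
qed

lemma poly_op_smult: "poly_op (smult c p) A = c *\<^sub>R poly_op p A"
  by (simp add: poly_op_eq_sum[OF degree_smult_le] poly_op_def[of p] scaleR_sum_right)

lemma poly_op_diff: "poly_op (p - q) A = poly_op p A - poly_op q A"
  using poly_op_add[of p "smult (- 1) q" A] poly_op_smult[of "- 1" q A] by simp

text \<open>Horner's recursion, on which the inductions over polynomials rest.\<close>

lemma poly_op_pCons: "poly_op (pCons a p) A = a *\<^sub>R id_blinfun + (A o\<^sub>L poly_op p A)"
proof -
  have "poly_op (pCons a p) A
      = (\<Sum>i\<le>Suc (degree p). coeff (pCons a p) i *\<^sub>R ((\<lambda>X. A o\<^sub>L X) ^^ i) id_blinfun)"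
    by (rule poly_op_eq_sum) (rule degree_pCons_le)
  also have "\<dots> = a *\<^sub>R id_blinfun
      + (\<Sum>i\<le>degree p. coeff p i *\<^sub>R (A o\<^sub>L ((\<lambda>X. A o\<^sub>L X) ^^ i) id_blinfun))"
    by (subst sum.atMost_Suc_shift) simp
  also have "\<dots> = a *\<^sub>R id_blinfun + (A o\<^sub>L poly_op p A)"
    by (simp add: poly_op_def blinfun_compose.sum_right blinfun_compose.scaleR_right)
  finally show ?thesis .
qed

lemma blinfun_compose_assoc: "A o\<^sub>L B o\<^sub>L C = A o\<^sub>L (B o\<^sub>L C)"
  by (rule blinfun_eqI) simp

lemma blinfun_compose_id [simp]: "A o\<^sub>L id_blinfun = A" "id_blinfun o\<^sub>L A = A"
  by (rule blinfun_eqI; simp)+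

lemma poly_op_mult: "poly_op (p * q) A = poly_op p A o\<^sub>L poly_op q A"
proof (induction p)
  case 0
  show ?case by (simp add: blinfun_compose.zero_left)
next
  case (pCons a p)
  have "pCons a p * q = smult a q + pCons 0 (p * q)" by (rule mult_pCons_left)
  then show ?case
    by (simp add: poly_op_add poly_op_smult poly_op_pCons pCons.IH blinfun_compose.add_left
        blinfun_compose.scaleR_left blinfun_compose_assoc)
qed

lemma poly_op_const: "poly_op [:c:] A = c *\<^sub>R id_blinfun"
  by (simp add: poly_op_pCons blinfun_compose.zero_right)

lemma poly_op_X: "poly_op [:0, 1:] A = A"
  by (simp add: poly_op_pCons blinfun_compose.zero_right)

lemma poly_op_commute: "poly_op p A o\<^sub>L poly_op q A = poly_op q A o\<^sub>L poly_op p A"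
  by (metis poly_op_mult mult.commute)

lemma selfadjoint_poly_op:
  assumes "selfadjoint_op A"
  shows "selfadjoint_op (poly_op p A)"
proof (induction p)
  case 0
  show ?case using selfadjoint_scaleR[OF selfadjoint_id, of 0] by simp
next
  case (pCons a p)
  \<comment> \<open>A product of self-adjoint operators is self-adjoint when the factors
    commute.\<close>
  have "A o\<^sub>L poly_op p A = poly_op p A o\<^sub>L A"
    using poly_op_commute[of "[:0, 1:]" A p] by (simp add: poly_op_X)
  then show ?case
    unfolding poly_op_pCons
    by (intro selfadjoint_add selfadjoint_scaleR selfadjoint_id selfadjoint_compose assms pCons.IH)
qed

section \<open>The real part of the spectrum\<close>

abbreviation real_spectrum :: "('a::complex_inner \<Rightarrow>\<^sub>L 'a) \<Rightarrow> real set" where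
  "real_spectrum A \<equiv> {x. complex_of_real x \<in> spectrum_op A}"

text \<open>For real \<open>x\<close> the operator \<open>A - x *\<^sub>R id_blinfun\<close> is
  again self-adjoint, and for such operators invertible means bounded below.\<close>

lemma real_spectrum_iff:
  fixes A :: "'a::chilbert_space \<Rightarrow>\<^sub>L 'a"
  assumes "selfadjoint_op A"
  shows "x \<in> real_spectrum A \<longleftrightarrow> \<not> bounded_below_op (A - x *\<^sub>R id_blinfun)"
  using assms
  by (auto simp: spectrum_op_def scalar_op_of_real
      intro: invertible_imp_bounded_below
        selfadjoint_bounded_below_imp_invertible selfadjoint_diff selfadjoint_scaleR selfadjoint_id)

section \<open>Real polynomials at complex points\<close>

lemma poly_map_of_real_add:
  "poly (map_poly complex_of_real (p + q)) z
    = poly (map_poly of_real p) z + poly (map_poly of_real q) z"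
proof -
  have "map_poly complex_of_real (p + q) = map_poly of_real p + map_poly of_real q"
    by (rule poly_eqI) (simp add: coeff_map_poly)
  then show ?thesis by simp
qed

lemma poly_map_of_real_mult:
  "poly (map_poly complex_of_real (p * q)) z
    = poly (map_poly of_real p) z * poly (map_poly of_real q) z"
proof (induction p)
  case (pCons a p)
  have "map_poly complex_of_real (smult a q) = smult (of_real a) (map_poly of_real q)"
    by (rule poly_eqI) (simp add: coeff_map_poly)
  then show ?case
    by (simp add: mult_pCons_left poly_map_of_real_add map_poly_pCons pCons.IH algebra_simps)
qed simp

lemma poly_map_of_real: "poly (map_poly complex_of_real p) (of_real x) = of_real (poly p x)"
  by (induction p) (simp_all add: map_poly_pCons)

text \<open>The quadratic is the product of \<open>X - z\<close> and \<open>X - cnj z\<close>. The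
  remainder on division by it is real of degree at most 1 and vanishes at the non-real point
  \<open>z\<close>, so it is zero.\<close>

lemma real_quadratic_divides:
  fixes q :: "real poly"
  assumes root: "poly (map_poly complex_of_real q) z = 0" and "Im z \<noteq> 0"
  shows "[:(cmod z)\<^sup>2, - 2 * Re z, 1:] dvd q"
proof -
  let ?d = "[:(cmod z)\<^sup>2, - 2 * Re z, 1:]"
  let ?c = "map_poly complex_of_real"
  define r where "r = q mod ?d"
  have "degree r < degree ?d \<or> r = 0"
    unfolding r_def using degree_mod_less'[of ?d q] by fastforce
  then have "degree r \<le> 1" by auto
  then have "r = [:coeff r 0, coeff r 1:]"
    by (intro poly_eqI) (auto simp: coeff_pCons coeff_eq_0 split: nat.splits)
  then obtain a b where r: "r = [:a, b:]" by blast
  have "?c ?d = [:of_real ((cmod z)\<^sup>2), - 2 * of_real (Re z), 1:]"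
    by (simp add: map_poly_pCons)
  then have d0: "poly (?c ?d) z = 0"
    using cmod_power2[of z] by (simp add: complex_eq_iff power2_eq_square algebra_simps)
  have "q = q div ?d * ?d + r"
    unfolding r_def by (rule div_mult_mod_eq[symmetric])
  then have "poly (?c q) z = poly (?c (q div ?d)) z * poly (?c ?d) z + poly (?c r) z"
    by (metis poly_map_of_real_add poly_map_of_real_mult)
  then have "poly (?c r) z = 0"
    using root d0 by simp
  then have "of_real a + z * of_real b = 0"
    by (simp add: r map_poly_pCons)
  then have "a = 0" "b = 0"
    using \<open>Im z \<noteq> 0\<close> by (auto simp: complex_eq_iff)
  then have "q mod ?d = 0" using r unfolding r_def by simp
  then show ?thesis by (rule mod_0_imp_dvd)
qed

text \<open>Factoring \<open>p\<close> over the reals, every linear factor \<open>A - z\<close> is bounded below since \<open>z\<close> is not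
  in the spectrum, and every irreducible quadratic factor \<open>(A - Re z)\<^sup>2 + (Im z)\<^sup>2\<close> is coercive.\<close>

lemma bounded_below_poly_op:
  fixes A :: "'a::chilbert_space \<Rightarrow>\<^sub>L 'a"
  assumes sa: "selfadjoint_op A" and "p \<noteq> 0" "\<And>x. x \<in> real_spectrum A \<Longrightarrow> poly p x \<noteq> 0"
  shows "bounded_below_op (poly_op p A)"
  using assms(2,3)
proof (induction "degree p" arbitrary: p rule: less_induct)
  case less
  show ?case
  proof (cases "degree p = 0")
    case True
    then obtain c where "p = [:c:]" by (rule degree_eq_zeroE)
    with less.prems show ?thesis
      unfolding bounded_below_op_def
      by (intro exI[of _ "\<bar>c\<bar>"]) (simp add: poly_op_const blinfun.scaleR_left)
  next
    case False
    let ?c = "map_poly complex_of_real"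
    have "degree (?c p) = degree p" by (rule degree_map_poly) simp
    then have "\<not> constant (poly (?c p))"
      using False by (simp add: constant_degree)
    then obtain z where z: "poly (?c p) z = 0"
      using fundamental_theorem_of_algebra by blast
    \<comment> \<open>It suffices to find one nonconstant divisor \<open>d\<close> that is bounded
      below at \<open>A\<close>: the cofactor has smaller degree and inherits the absence of zeros
      on the spectrum.\<close>
    have step: ?thesis if "d dvd p" "degree d > 0" "bounded_below_op (poly_op d A)" for d
    proof -
      from \<open>d dvd p\<close> obtain s where s: "p = d * s" by (elim dvdE)
      with less.prems have nz: "d \<noteq> 0" "s \<noteq> 0" by auto
      then have "degree s < degree p" using \<open>degree d > 0\<close> by (simp add: s degree_mult_eq)
      then have "bounded_below_op (poly_op s A)"
        using less.prems(2) nz by (intro less.hyps) (auto simp: s)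
      then show ?thesis
        unfolding s poly_op_mult using that(3) by (intro bounded_below_compose)
    qed
    show ?thesis
    proof (cases "Im z = 0")
      case True
      then have "z = of_real (Re z)" by (simp add: complex_eq_iff)
      with z have "poly p (Re z) = 0"
        by (metis of_real_eq_0_iff poly_map_of_real)
      show ?thesis
      proof (rule step)
        show "[:- Re z, 1:] dvd p" using \<open>poly p (Re z) = 0\<close> by (simp add: poly_eq_0_iff_dvd)
        have "Re z \<notin> real_spectrum A" using less.prems(2) \<open>poly p (Re z) = 0\<close> by blast
        moreover have "poly_op [:- Re z, 1:] A = A - Re z *\<^sub>R id_blinfun"
          by (simp add: poly_op_pCons blinfun_compose.zero_right)
        ultimately show "bounded_below_op (poly_op [:- Re z, 1:] A)"
          using real_spectrum_iff[OF sa] by simp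
      qed simp
    next
      case False
      show ?thesis
      proof (rule step)
        show "[:(cmod z)\<^sup>2, - 2 * Re z, 1:] dvd p" by (rule real_quadratic_divides[OF z False])
        let ?l = "[:- Re z, 1:]"
        have "[:(cmod z)\<^sup>2, - 2 * Re z, 1:] = ?l * ?l + [:(Im z)\<^sup>2:]"
          using cmod_power2[of z] by (simp add: power2_eq_square)
        then have eq: "poly_op [:(cmod z)\<^sup>2, - 2 * Re z, 1:] A
            = (poly_op ?l A o\<^sub>L poly_op ?l A) + (Im z)\<^sup>2 *\<^sub>R id_blinfun"
          by (simp only: poly_op_add poly_op_mult poly_op_const)
        show "bounded_below_op (poly_op [:(cmod z)\<^sup>2, - 2 * Re z, 1:] A)"
        proof (rule coercive_imp_bounded_below)
          show "(Im z)\<^sup>2 > 0" using False by simp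
          show "(Im z)\<^sup>2 * (norm x)\<^sup>2 \<le> rip (poly_op [:(cmod z)\<^sup>2, - 2 * Re z, 1:] A x) x" for x
            unfolding eq
            by (simp add: blinfun.add_left blinfun.scaleR_left rip_add_left rip_scaleR_left rip_self
                selfadjoint_rip[OF selfadjoint_poly_op[OF sa]])
        qed
      qed simp
    qed
  qed
qed

text \<open>The infimum of the form of \<open>S\<close> over the unit sphere lies in the spectrum: otherwise
  \<open>S - m\<close> would be coercive and \<open>m\<close> could be increased.\<close>

lemma real_spectrum_below_form:
  fixes S :: "'a::chilbert_space \<Rightarrow>\<^sub>L 'a"
  assumes sa: "selfadjoint_op S" and "x \<noteq> 0"
  obtains m where "m \<in> real_spectrum S" "m * (norm x)\<^sup>2 \<le> rip (S x) x"
proof -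
  define V where "V = {rip (S u) u | u. norm u = 1}"
  define m where "m = Inf V"
  have bdd: "bdd_below V"
  proof (rule bdd_belowI)
    fix v assume "v \<in> V"
    then obtain u where "v = rip (S u) u" "norm u = 1" unfolding V_def by blast
    then show "- norm S \<le> v"
      using abs_rip_le[of "S u" u] norm_blinfun[of S u] by simp
  qed
  have V: "rip (S y) y / (norm y)\<^sup>2 \<in> V" if "y \<noteq> 0" for y
    unfolding V_def using that
    by (intro CollectI exI[of _ "inverse (norm y) *\<^sub>R y"])
      (simp add: blinfun.scaleR_right rip_scaleR_left rip_scaleR_right power2_eq_square field_simps)
  have form_ge: "m * (norm y)\<^sup>2 \<le> rip (S y) y" for y
  proof (cases "y = 0")
    case False
    then show ?thesis
      using cInf_lower[OF V[OF False] bdd] by (simp add: m_def pos_le_divide_eq)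
  qed (simp add: rip.zero_right)
  let ?P = "S - m *\<^sub>R id_blinfun"
  have P: "rip (?P y) y = rip (S y) y - m * (norm y)\<^sup>2" for y
    by (simp add: blinfun.diff_left blinfun.scaleR_left rip_diff_left rip_scaleR_left rip_self)
  have "\<not> bounded_below_op ?P"
  proof
    assume "bounded_below_op ?P"
    moreover have "selfadjoint_op ?P"
      by (intro selfadjoint_diff selfadjoint_scaleR selfadjoint_id sa)
    moreover have "0 \<le> rip (?P y) y" for y using form_ge[of y] by (simp add: P)
    ultimately obtain \<delta> where "\<delta> > 0" and \<delta>: "\<And>y. \<delta> * (norm y)\<^sup>2 \<le> rip (?P y) y"
      using positive_bounded_below_imp_coercive by blast
    have "m + \<delta> \<le> Inf V"
    proof (rule cInf_greatest)
      show "V \<noteq> {}" using V[OF \<open>x \<noteq> 0\<close>] by blast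
      fix v assume "v \<in> V"
      then obtain u where "v = rip (S u) u" "norm u = 1" unfolding V_def by blast
      then show "m + \<delta> \<le> v" using \<delta>[of u] by (simp add: P)
    qed
    with \<open>\<delta> > 0\<close> show False by (simp add: m_def)
  qed
  then have "m \<in> real_spectrum S" using real_spectrum_iff[OF sa] by blast
  then show ?thesis using form_ge by (intro that[of m])
qed

text \<open>A spectral point \<open>m\<close> of \<open>poly_op p A\<close> below its form at
  \<open>y\<close> must be a value of \<open>p\<close> on the spectrum of \<open>A\<close>;
  otherwise \<open>p - [:m:]\<close> would have no zero there and \<open>poly_op p A - m\<close>
  would be bounded below. Hence \<open>m\<close> is nonnegative.\<close>

lemma poly_op_nonneg:
  fixes A :: "'a::chilbert_space \<Rightarrow>\<^sub>L 'a"
  assumes sa: "selfadjoint_op A" and nonneg: "\<And>x. x \<in> real_spectrum A \<Longrightarrow> 0 \<le> poly p x"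
  shows "0 \<le> rip (poly_op p A y) y"
proof (cases "y = 0")
  case False
  have sap: "selfadjoint_op (poly_op p A)" by (rule selfadjoint_poly_op[OF sa])
  obtain m where m: "m \<in> real_spectrum (poly_op p A)" "m * (norm y)\<^sup>2 \<le> rip (poly_op p A y) y"
    by (rule real_spectrum_below_form[OF sap False])
  have "poly_op p A - m *\<^sub>R id_blinfun = poly_op (p - [:m:]) A"
    by (simp add: poly_op_diff poly_op_const)
  then have "\<not> bounded_below_op (poly_op (p - [:m:]) A)"
    using m(1) real_spectrum_iff[OF sap] by simp
  then have "p - [:m:] = 0 \<or> (\<exists>x\<in>real_spectrum A. poly (p - [:m:]) x = 0)"
    using bounded_below_poly_op[OF sa] by blast
  \<comment> \<open>If \<open>p\<close> is the constant \<open>m\<close>, any spectral point serves;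
    one exists because \<open>y\<close> is nonzero.\<close>
  moreover obtain x where "x \<in> real_spectrum A"
    using real_spectrum_below_form[OF sa False] by blast
  ultimately obtain x where "x \<in> real_spectrum A" "poly (p - [:m:]) x = 0"
    by force
  then have "0 \<le> m" using nonneg[of x] by simp
  then show ?thesis using m(2) by (meson mult_nonneg_nonneg order_trans zero_le_power2)
qed (simp add: rip.zero_right)

lemma norm_poly_op_le:
  fixes A :: "'a::chilbert_space \<Rightarrow>\<^sub>L 'a"
  assumes sa: "selfadjoint_op A" and "0 \<le> c" and "\<And>x. x \<in> real_spectrum A \<Longrightarrow> \<bar>poly p x\<bar> \<le> c"
  shows "norm (poly_op p A) \<le> c"
proof (rule norm_blinfun_bound[OF \<open>0 \<le> c\<close>])
  fix y
  let ?q = "[:c\<^sup>2:] - p * p"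
  have "0 \<le> rip (poly_op ?q A y) y"
  proof (rule poly_op_nonneg[OF sa])
    fix x assume "x \<in> real_spectrum A"
    then have "\<bar>poly p x\<bar>\<^sup>2 \<le> c\<^sup>2" using assms(3) by (intro power_mono) auto
    then show "0 \<le> poly ?q x" by (simp add: power2_eq_square)
  qed
  then have "(norm (poly_op p A y))\<^sup>2 \<le> (c * norm y)\<^sup>2"
    by (simp add: poly_op_diff poly_op_mult poly_op_const blinfun.diff_left blinfun.scaleR_left
        rip_diff_left rip_scaleR_left rip_self power_mult_distrib
        selfadjoint_rip[OF selfadjoint_poly_op[OF sa]])
  then show "norm (poly_op p A y) \<le> c * norm y"
    by (rule power2_le_imp_le) (simp add: \<open>0 \<le> c\<close>)
qed

section \<open>Location and compactness of the spectrum\<close>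

lemma real_spectrum_ge:
  fixes A :: "'a::chilbert_space \<Rightarrow>\<^sub>L 'a"
  assumes sa: "selfadjoint_op A" and ge: "\<And>y. m * (norm y)\<^sup>2 \<le> rip (A y) y"
    and x: "x \<in> real_spectrum A"
  shows "m \<le> x"
proof (rule ccontr)
  assume "\<not> m \<le> x"
  have "bounded_below_op (A - x *\<^sub>R id_blinfun)"
  proof (rule coercive_imp_bounded_below)
    show "m - x > 0" using \<open>\<not> m \<le> x\<close> by simp
    show "(m - x) * (norm y)\<^sup>2 \<le> rip ((A - x *\<^sub>R id_blinfun) y) y" for y
      using ge[of y]
      by (simp add: blinfun.diff_left blinfun.scaleR_left rip_diff_left rip_scaleR_left rip_self
          algebra_simps)
  qed
  then show False using x real_spectrum_iff[OF sa] by blast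
qed

text \<open>Mirror image of the lower bound: for \<open>x > M\<close> the operator
  \<open>x - A\<close> is coercive with constant \<open>x - M\<close>, and changing the sign does
  not affect norms.\<close>

lemma real_spectrum_le:
  fixes A :: "'a::chilbert_space \<Rightarrow>\<^sub>L 'a"
  assumes sa: "selfadjoint_op A" and le: "\<And>y. rip (A y) y \<le> M * (norm y)\<^sup>2"
    and x: "x \<in> real_spectrum A"
  shows "x \<le> M"
proof (rule ccontr)
  assume "\<not> x \<le> M"
  have "bounded_below_op (- (A - x *\<^sub>R id_blinfun))"
  proof (rule coercive_imp_bounded_below)
    show "x - M > 0" using \<open>\<not> x \<le> M\<close> by simp
    show "(x - M) * (norm y)\<^sup>2 \<le> rip ((- (A - x *\<^sub>R id_blinfun)) y) y" for y
      using le[of y]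
      by (simp add: blinfun.diff_left blinfun.minus_left blinfun.scaleR_left rip_diff_left
          rip_scaleR_left rip_self algebra_simps)
  qed
  then have "bounded_below_op (A - x *\<^sub>R id_blinfun)"
    unfolding bounded_below_op_def by (simp add: blinfun.diff_left norm_minus_commute)
  then show False using x real_spectrum_iff[OF sa] by blast
qed

text \<open>The form lies between \<open>- norm A\<close> and \<open>norm A\<close> on unit vectors,
  so the spectrum is bounded. Its complement is open because a lower bound \<open>c\<close> of
  \<open>A - x\<close> leaves \<open>c - dist z x\<close> for \<open>A - z\<close>.\<close>

lemma compact_real_spectrum:
  fixes A :: "'a::chilbert_space \<Rightarrow>\<^sub>L 'a"
  assumes sa: "selfadjoint_op A"
  shows "compact (real_spectrum A)"
proof -
  have "\<bar>rip (A y) y\<bar> \<le> norm A * (norm y)\<^sup>2" for y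
    using order_trans[OF abs_rip_le[of "A y" y] mult_right_mono[OF norm_blinfun[of A y]]]
    by (simp add: power2_eq_square mult.assoc)
  then have "- norm A * (norm y)\<^sup>2 \<le> rip (A y) y" "rip (A y) y \<le> norm A * (norm y)\<^sup>2" for y
    by (simp_all add: abs_le_iff minus_le_iff)
  then have "real_spectrum A \<subseteq> {- norm A..norm A}"
    using real_spectrum_ge[OF sa] real_spectrum_le[OF sa] by (meson atLeastAtMost_iff subsetI)
  then have "bounded (real_spectrum A)" using bounded_closed_interval bounded_subset by blast
  moreover have "open (- real_spectrum A)"
    unfolding open_dist
  proof
    fix x assume "x \<in> - real_spectrum A"
    then obtain c where "c > 0" and c: "\<And>y. c * norm y \<le> norm ((A - x *\<^sub>R id_blinfun) y)"
      using real_spectrum_iff[OF sa, of x] unfolding bounded_below_op_def by blast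
    have "z \<in> - real_spectrum A" if "dist z x < c" for z
    proof -
      have "(c - dist z x) * norm y \<le> norm ((A - z *\<^sub>R id_blinfun) y)" for y
      proof -
        have "(A - x *\<^sub>R id_blinfun) y = (A - z *\<^sub>R id_blinfun) y + (z - x) *\<^sub>R y"
          by (simp add: blinfun.diff_left blinfun.scaleR_left algebra_simps)
        then have "norm ((A - x *\<^sub>R id_blinfun) y) \<le> norm ((A - z *\<^sub>R id_blinfun) y) + dist z x * norm y"
          by (metis norm_triangle_ineq norm_scaleR dist_real_def)
        then show ?thesis using c[of y] by (simp add: algebra_simps)
      qed
      then have "bounded_below_op (A - z *\<^sub>R id_blinfun)"
        unfolding bounded_below_op_def using that by (intro exI[of _ "c - dist z x"]) simp
      then show ?thesis using real_spectrum_iff[OF sa] by blast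
    qed
    then show "\<exists>e>0. \<forall>z. dist z x < e \<longrightarrow> z \<in> - real_spectrum A"
      using \<open>c > 0\<close> by blast
  qed
  ultimately show ?thesis by (simp add: compact_eq_bounded_closed closed_def)
qed

section \<open>The functional calculus\<close>

text \<open>Stone-Weierstrass with error \<open>1 / (n + 1)\<close> at step \<open>n\<close>, with
  the approximant rewritten as a value of \<open>poly\<close>.\<close>

lemma Weierstrass_poly_sequence:
  fixes f :: "real \<Rightarrow> real"
  assumes "compact K" "continuous_on K f"
  obtains p where "uniform_limit K (\<lambda>n. poly (p n)) f sequentially"
proof -
  have "\<exists>q. \<forall>x\<in>K. \<bar>f x - poly q x\<bar> < inverse (real (Suc n))" for n
  proof -
    obtain g where g: "real_polynomial_function g"
      "\<And>x. x \<in> K \<Longrightarrow> \<bar>f x - g x\<bar> < inverse (real (Suc n))"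
      using Stone_Weierstrass_real_polynomial_function[OF assms, of "inverse (real (Suc n))"] by auto
    then obtain a m where "g = (\<lambda>x. \<Sum>i\<le>m. a i * x ^ i)"
      using real_polynomial_function_iff_sum by blast
    then have "g = poly (\<Sum>i\<le>m. monom (a i) i)"
      by (simp add: fun_eq_iff poly_sum poly_monom)
    then show ?thesis using g(2) by blast
  qed
  then obtain p where p: "\<And>n x. x \<in> K \<Longrightarrow> \<bar>f x - poly (p n) x\<bar> < inverse (real (Suc n))"
    by metis
  have "uniform_limit K (\<lambda>n. poly (p n)) f sequentially"
  proof (rule uniform_limitI)
    fix e :: real assume "e > 0"
    then have "\<forall>\<^sub>F n in sequentially. inverse (real (Suc n)) < e"
      using LIMSEQ_inverse_real_of_nat by (rule order_tendstoD(2)[rotated])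
    then show "\<forall>\<^sub>F n in sequentially. \<forall>x\<in>K. dist (poly (p n) x) (f x) < e"
      by eventually_elim (metis p abs_minus_commute dist_real_def order_less_trans)
  qed
  then show ?thesis by (rule that)
qed

lemma poly_op_dist_le:
  fixes A :: "'a::chilbert_space \<Rightarrow>\<^sub>L 'a"
  assumes "selfadjoint_op A" "0 < e"
    and "\<forall>x\<in>real_spectrum A. dist (poly p x) (f x) < e"
    and "\<forall>x\<in>real_spectrum A. dist (poly q x) (f x) < e"
  shows "dist (poly_op p A) (poly_op q A) \<le> 2 * e"
  unfolding dist_norm poly_op_diff[symmetric]
proof (rule norm_poly_op_le[OF assms(1)])
  fix x assume "x \<in> real_spectrum A"
  then show "\<bar>poly (p - q) x\<bar> \<le> 2 * e"
    using assms(3,4) by (fastforce simp: dist_real_def abs_if split: if_splits)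
qed (use \<open>0 < e\<close> in simp)

text \<open>One approximating sequence yields a Cauchy sequence of operators; any other sequence for
  the same \<open>f\<close> stays asymptotically close to it. The common limit makes the description
  in \<open>cfc\<close> meaningful.\<close>

lemma poly_op_converges:
  fixes A :: "'a::chilbert_space \<Rightarrow>\<^sub>L 'a"
  assumes sa: "selfadjoint_op A" and cont: "continuous_on (real_spectrum A) f"
  shows "\<exists>T. \<forall>p. uniform_limit (real_spectrum A) (\<lambda>n. poly (p n)) f sequentially
    \<longrightarrow> (\<lambda>n. poly_op (p n) A) \<longlonglongrightarrow> T"
proof -
  obtain p where p: "uniform_limit (real_spectrum A) (\<lambda>n. poly (p n)) f sequentially"
    using Weierstrass_poly_sequence[OF compact_real_spectrum[OF sa] cont] .
  have "Cauchy (\<lambda>n. poly_op (p n) A)"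
  proof (rule metric_CauchyI)
    fix e :: real assume "e > 0"
    \<comment> \<open>Two errors of \<open>e / 3\<close> add up to \<open>2 * e / 3\<close>,
      strictly below \<open>e\<close>.\<close>
    then obtain N where N: "\<And>n. n \<ge> N \<Longrightarrow> \<forall>x\<in>real_spectrum A. dist (poly (p n) x) (f x) < e / 3"
      using uniform_limitD[OF p, of "e / 3"] by (auto simp: eventually_sequentially)
    have "dist (poly_op (p m) A) (poly_op (p n) A) < e" if "m \<ge> N" "n \<ge> N" for m n
      using poly_op_dist_le[OF sa _ N[OF that(1)] N[OF that(2)]] \<open>e > 0\<close> by simp
    then show "\<exists>N. \<forall>m\<ge>N. \<forall>n\<ge>N. dist (poly_op (p m) A) (poly_op (p n) A) < e" by blast
  qed
  then obtain T where T: "(\<lambda>n. poly_op (p n) A) \<longlonglongrightarrow> T"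
    using convergent_eq_Cauchy by blast
  have "(\<lambda>n. poly_op (q n) A) \<longlonglongrightarrow> T"
    if q: "uniform_limit (real_spectrum A) (\<lambda>n. poly (q n)) f sequentially" for q
  proof -
    have "(\<lambda>n. dist (poly_op (q n) A) (poly_op (p n) A)) \<longlonglongrightarrow> 0"
    proof (rule tendstoI)
      fix e :: real assume "e > 0"
      then have "e / 3 > 0" by simp
      from uniform_limitD[OF p this] uniform_limitD[OF q this]
      show "\<forall>\<^sub>F n in sequentially. dist (dist (poly_op (q n) A) (poly_op (p n) A)) 0 < e"
      proof eventually_elim
        case (elim n)
        then show ?case
          using poly_op_dist_le[OF sa _ elim(2,1)] \<open>e > 0\<close> by simp
      qed
    qed
    with T show ?thesis
      by (simp add: dist_norm) (metis Lim_transform LIM_zero_iff tendsto_norm_zero_iff)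
  qed
  then show ?thesis by blast
qed

lemma cfc_LIMSEQ:
  fixes A :: "'a::chilbert_space \<Rightarrow>\<^sub>L 'a"
  assumes sa: "selfadjoint_op A" and cont: "continuous_on (real_spectrum A) f"
    and p: "uniform_limit (real_spectrum A) (\<lambda>n. poly (p n)) f sequentially"
  shows "(\<lambda>n. poly_op (p n) A) \<longlonglongrightarrow> cfc f A"
proof -
  obtain T where T: "\<forall>p. uniform_limit (real_spectrum A) (\<lambda>n. poly (p n)) f sequentially
      \<longrightarrow> (\<lambda>n. poly_op (p n) A) \<longlonglongrightarrow> T"
    using poly_op_converges[OF sa cont] by blast
  \<comment> \<open>Uniqueness comes from the actual sequence \<open>p\<close>: without any
    approximating sequence the defining property would hold vacuously.\<close>
  have "cfc f A = T"
    unfolding cfc_def using T p by (intro the_equality) (auto intro: LIMSEQ_unique)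
  with T p show ?thesis by blast
qed

lemma cfc_eqI:
  fixes A :: "'a::chilbert_space \<Rightarrow>\<^sub>L 'a"
  assumes "selfadjoint_op A" "continuous_on (real_spectrum A) f"
    and "uniform_limit (real_spectrum A) (\<lambda>n. poly (p n)) f sequentially"
    and "(\<lambda>n. poly_op (p n) A) \<longlonglongrightarrow> T"
  shows "cfc f A = T"
  using cfc_LIMSEQ[OF assms(1-3)] assms(4) by (rule LIMSEQ_unique)

section \<open>Algebra and positivity of the calculus\<close>

context
  fixes A :: "'a::chilbert_space \<Rightarrow>\<^sub>L 'a"
  assumes sa: "selfadjoint_op A"
begin

lemma cfc_approx:
  assumes "continuous_on (real_spectrum A) f"
  obtains p where "uniform_limit (real_spectrum A) (\<lambda>n. poly (p n)) f sequentially"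
    and "(\<lambda>n. poly_op (p n) A) \<longlonglongrightarrow> cfc f A"
  using Weierstrass_poly_sequence[OF compact_real_spectrum[OF sa] assms] cfc_LIMSEQ[OF sa assms]
  by metis

lemma selfadjoint_cfc:
  assumes "continuous_on (real_spectrum A) f"
  shows "selfadjoint_op (cfc f A)"
  using cfc_approx[OF assms] selfadjoint_limit selfadjoint_poly_op[OF sa] by metis

lemma cfc_poly: "cfc (poly p) A = poly_op p A"
  by (rule cfc_eqI[OF sa, of _ "\<lambda>_. p"]) (intro continuous_intros uniform_limit_const tendsto_const)+

lemma cfc_cong:
  assumes "continuous_on (real_spectrum A) f" "\<And>x. x \<in> real_spectrum A \<Longrightarrow> f x = g x"
  shows "cfc f A = cfc g A"
proof -
  obtain p where p: "uniform_limit (real_spectrum A) (\<lambda>n. poly (p n)) f sequentially"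
    "(\<lambda>n. poly_op (p n) A) \<longlonglongrightarrow> cfc f A"
    using cfc_approx[OF assms(1)] .
  have "continuous_on (real_spectrum A) g"
    by (rule continuous_on_eq[OF assms])
  moreover have "uniform_limit (real_spectrum A) (\<lambda>n. poly (p n)) g sequentially"
    using p(1) assms(2) by (subst uniform_limit_cong') auto
  ultimately have "cfc g A = cfc f A"
    using p(2) by (intro cfc_eqI[OF sa])
  then show ?thesis ..
qed

lemma cfc_lincomb:
  assumes "continuous_on (real_spectrum A) f" "continuous_on (real_spectrum A) g"
  shows "cfc (\<lambda>x. a * f x + b * g x) A = a *\<^sub>R cfc f A + b *\<^sub>R cfc g A"
proof -
  obtain p where p: "uniform_limit (real_spectrum A) (\<lambda>n. poly (p n)) f sequentially"
    "(\<lambda>n. poly_op (p n) A) \<longlonglongrightarrow> cfc f A"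
    using cfc_approx[OF assms(1)] .
  obtain q where q: "uniform_limit (real_spectrum A) (\<lambda>n. poly (q n)) g sequentially"
    "(\<lambda>n. poly_op (q n) A) \<longlonglongrightarrow> cfc g A"
    using cfc_approx[OF assms(2)] .
  show ?thesis
  proof (rule cfc_eqI[OF sa, of _ "\<lambda>n. smult a (p n) + smult b (q n)"])
    show "continuous_on (real_spectrum A) (\<lambda>x. a * f x + b * g x)"
      by (intro continuous_intros assms)
    have "uniform_limit (real_spectrum A) (\<lambda>n x. a * poly (p n) x + b * poly (q n) x)
        (\<lambda>x. a * f x + b * g x) sequentially"
      by (intro uniform_limit_intros p q)
    moreover have "poly (smult a (p n) + smult b (q n)) = (\<lambda>x. a * poly (p n) x + b * poly (q n) x)"
      for n by (simp add: fun_eq_iff)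
    ultimately show "uniform_limit (real_spectrum A) (\<lambda>n. poly (smult a (p n) + smult b (q n)))
        (\<lambda>x. a * f x + b * g x) sequentially"
      by (simp only:)
    show "(\<lambda>n. poly_op (smult a (p n) + smult b (q n)) A) \<longlonglongrightarrow> a *\<^sub>R cfc f A + b *\<^sub>R cfc g A"
      unfolding poly_op_add poly_op_smult by (intro tendsto_intros p q)
  qed
qed

lemma cfc_mult:
  assumes "continuous_on (real_spectrum A) f" "continuous_on (real_spectrum A) g"
  shows "cfc (\<lambda>x. f x * g x) A = cfc f A o\<^sub>L cfc g A"
proof -
  obtain p where p: "uniform_limit (real_spectrum A) (\<lambda>n. poly (p n)) f sequentially"
    "(\<lambda>n. poly_op (p n) A) \<longlonglongrightarrow> cfc f A"
    using cfc_approx[OF assms(1)] .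
  obtain q where q: "uniform_limit (real_spectrum A) (\<lambda>n. poly (q n)) g sequentially"
    "(\<lambda>n. poly_op (q n) A) \<longlonglongrightarrow> cfc g A"
    using cfc_approx[OF assms(2)] .
  \<comment> \<open>Uniform convergence passes to products when the limit functions are bounded,
    which compactness of the spectrum provides.\<close>
  have bdd: "bounded (h ` real_spectrum A)" if "continuous_on (real_spectrum A) h"
    for h :: "real \<Rightarrow> real"
    using that compact_real_spectrum[OF sa] by (intro compact_imp_bounded compact_continuous_image)
  show ?thesis
  proof (rule cfc_eqI[OF sa, of _ "\<lambda>n. p n * q n"])
    show "continuous_on (real_spectrum A) (\<lambda>x. f x * g x)"
      by (intro continuous_intros assms)
    have "poly (p n * q n) = (\<lambda>x. poly (p n) x * poly (q n) x)" for n
      by (simp add: fun_eq_iff)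
    then show "uniform_limit (real_spectrum A) (\<lambda>n. poly (p n * q n)) (\<lambda>x. f x * g x) sequentially"
      using uniform_lim_mult[OF p(1) q(1) bdd[OF assms(1)] bdd[OF assms(2)]] by (simp only:)
    show "(\<lambda>n. poly_op (p n * q n) A) \<longlonglongrightarrow> (cfc f A o\<^sub>L cfc g A)"
      unfolding poly_op_mult by (intro blinfun_compose.tendsto p q)
  qed
qed

text \<open>Multiplicativity exhibits the operator as the square of the self-adjoint
  \<open>cfc (\<lambda>x. sqrt (f x)) A\<close>, so its form at \<open>y\<close> is a squared
  norm.\<close>

lemma cfc_nonneg:
  assumes cont: "continuous_on (real_spectrum A) f"
    and nonneg: "\<And>x. x \<in> real_spectrum A \<Longrightarrow> 0 \<le> f x"
  shows "0 \<le> rip (cfc f A y) y"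
proof -
  have s: "continuous_on (real_spectrum A) (\<lambda>x. sqrt (f x))"
    by (intro continuous_intros cont)
  have "cfc f A = cfc (\<lambda>x. sqrt (f x) * sqrt (f x)) A"
    using nonneg by (intro cfc_cong cont) simp
  also have "\<dots> = cfc (\<lambda>x. sqrt (f x)) A o\<^sub>L cfc (\<lambda>x. sqrt (f x)) A"
    by (rule cfc_mult[OF s s])
  finally show ?thesis
    by (simp add: selfadjoint_rip[OF selfadjoint_cfc[OF s]] rip_self)
qed

end

section \<open>Convexity in the parameter\<close>

text \<open>The bracket has derivative \<open>exp u * u\<^sup>2\<close> and vanishes at 0, so it has
  the sign of \<open>u\<close>. The factor \<open>s\<close> treats both signs at once.\<close>

lemma exp_quadratic_sign:
  fixes s u :: real
  assumes "0 \<le> s * u"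
  shows "0 \<le> s * (exp u * (u\<^sup>2 - 2 * u + 2) - 2)"
proof -
  let ?f = "\<lambda>u::real. exp u * (u\<^sup>2 - 2 * u + 2) - 2"
  have d: "(?f has_real_derivative exp v * v\<^sup>2) (at v)" for v
    by (auto intro!: derivative_eq_intros simp: algebra_simps power2_eq_square)
  have mono: "?f v \<le> ?f w" if "v \<le> w" for v w
    using that by (rule DERIV_nonneg_imp_nondecreasing) (use d in fastforce)
  consider "s > 0" "u \<ge> 0" | "s = 0" | "s < 0" "u \<le> 0"
    using assms by (fastforce simp: zero_le_mult_iff)
  then show ?thesis
  proof cases
    case 1
    then show ?thesis using mono[of 0 u] by simp
  next
    case 3
    then show ?thesis using mono[of u 0] by (intro mult_nonpos_nonpos) auto
  qed simp
qed

text \<open>With \<open>s = 1\<close> this is convexity for \<open>x\<close> at least 1, with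
  \<open>s = - 1\<close> concavity for \<open>x\<close> at most 1. The second derivative is
  nonnegative by \<open>exp_quadratic_sign\<close> at \<open>u = t * ln x\<close>.\<close>

lemma convex_on_tsallis_ln:
  assumes "x > 0" "0 \<le> s * ln x"
  shows "convex_on {0<..} (\<lambda>t. s * tsallis_ln t x)"
proof -
  let ?L = "ln x"
  let ?e = "\<lambda>t. exp (t * ?L)"
  have "convex_on {0<..} (\<lambda>t. s * ((?e t - 1) / t))"
  proof (rule f''_ge0_imp_convex)
    fix t :: real assume "t \<in> {0<..}"
    then have "t > 0" by simp
    then show "((\<lambda>t. s * ((?e t - 1) / t)) has_real_derivative
        s * ((?L * t * ?e t - ?e t + 1) / t\<^sup>2)) (at t)"
      by (auto intro!: derivative_eq_intros simp: field_simps power2_eq_square)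
    show "((\<lambda>t. s * ((?L * t * ?e t - ?e t + 1) / t\<^sup>2)) has_real_derivative
        s * (?e t * ((t * ?L)\<^sup>2 - 2 * (t * ?L) + 2) - 2) / t ^ 3) (at t)"
      using \<open>t > 0\<close>
      by (auto intro!: derivative_eq_intros
          simp: field_simps power2_eq_square power3_eq_cube)
    have "0 \<le> s * (t * ?L)"
      using mult_nonneg_nonneg[OF less_imp_le[OF \<open>t > 0\<close>] assms(2)] by (simp add: mult.left_commute)
    then show "0 \<le> s * (?e t * ((t * ?L)\<^sup>2 - 2 * (t * ?L) + 2) - 2) / t ^ 3"
      using exp_quadratic_sign \<open>t > 0\<close> by (intro divide_nonneg_pos) auto
  qed simp
  then show ?thesis using \<open>x > 0\<close> by (simp add: tsallis_ln_def powr_def)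
qed

section \<open>The operator inequality\<close>

text \<open>Invertibility gives a lower norm bound, which positivity upgrades to a lower bound of
  the form.\<close>

lemma strictly_positive_imp_coercive:
  assumes "selfadjoint_op A" "strictly_positive_op A"
  obtains \<delta> where "\<delta> > 0" "\<And>x. \<delta> * (norm x)\<^sup>2 \<le> rip (A x) x"
  using assms positive_bounded_below_imp_coercive[of A]
  by (metis invertible_imp_bounded_below positive_op_iff strictly_positive_op_def)

lemma le_op_iff:
  assumes "selfadjoint_op A" "selfadjoint_op B"
  shows "A \<le>\<^sub>o\<^sub>p B \<longleftrightarrow> (\<forall>x. rip (A x) x \<le> rip (B x) x)"
  using assms positive_op_iff[OF selfadjoint_diff[OF assms(2,1)]]
  by (simp add: le_op_def blinfun.diff_left rip_diff_left)

section \<open>Powers and Tsallis logarithms on a positive spectrum\<close>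

context
  fixes A :: "'a::chilbert_space \<Rightarrow>\<^sub>L 'a"
  assumes sa: "selfadjoint_op A" and pos: "\<And>x. x \<in> real_spectrum A \<Longrightarrow> 0 < x"
begin

lemma continuous_on_powr_spectrum: "continuous_on (real_spectrum A) (\<lambda>x. x powr r)"
  by (intro continuous_intros) (use pos in force)

lemma selfadjoint_powr_op: "selfadjoint_op (powr_op A r)"
  unfolding powr_op_def by (rule selfadjoint_cfc[OF sa continuous_on_powr_spectrum])

lemma powr_op_add: "powr_op A (r + s) = powr_op A r o\<^sub>L powr_op A s"
  by (simp add: powr_op_def powr_add cfc_mult[OF sa continuous_on_powr_spectrum continuous_on_powr_spectrum])

lemma powr_op_0: "powr_op A 0 = id_blinfun"
proof -
  have "powr_op A 0 = cfc (poly [:1:]) A"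
    unfolding powr_op_def
    \<comment> \<open>Positivity matters because \<open>0 powr 0\<close> is 0, not 1.\<close>
    by (rule cfc_cong[OF sa continuous_on_powr_spectrum]) (use pos in force)
  then show ?thesis by (simp add: cfc_poly[OF sa] poly_op_const)
qed

lemma powr_op_1: "powr_op A 1 = A"
proof -
  have "powr_op A 1 = cfc (poly [:0, 1:]) A"
    unfolding powr_op_def
    by (rule cfc_cong[OF sa continuous_on_powr_spectrum]) (use pos in force)
  then show ?thesis by (simp add: cfc_poly[OF sa] poly_op_X)
qed

lemma continuous_on_tsallis_ln_spectrum:
  "continuous_on (real_spectrum A) (tsallis_ln t)"
  unfolding tsallis_ln_def divide_inverse
  by (intro continuous_intros continuous_on_powr_spectrum)

lemma cfc_tsallis_ln_convex:
  assumes sign: "\<And>x. x \<in> real_spectrum A \<Longrightarrow> 0 \<le> s * ln x"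
    and "0 < a" "0 < b" "0 \<le> t" "t \<le> 1"
  shows "s * rip (cfc (tsallis_ln ((1 - t) * a + t * b)) A y) y
    \<le> s * ((1 - t) * rip (cfc (tsallis_ln a) A y) y + t * rip (cfc (tsallis_ln b) A y) y)"
proof -
  let ?c = "(1 - t) * a + t * b"
  let ?g = "\<lambda>x. (1 - t) * tsallis_ln a x + t * tsallis_ln b x"
  have g: "continuous_on (real_spectrum A) ?g"
    by (intro continuous_intros continuous_on_tsallis_ln_spectrum)
  \<comment> \<open>The scaled convexity gap, written as a linear combination so that
    \<open>cfc_lincomb\<close> applies.\<close>
  let ?h = "\<lambda>x. s * ?g x + (- s) * tsallis_ln ?c x"
  have "0 \<le> rip (cfc ?h A y) y"
  proof (rule cfc_nonneg[OF sa])
    show "continuous_on (real_spectrum A) ?h"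
      by (intro continuous_on_add continuous_on_mult continuous_on_const g continuous_on_tsallis_ln_spectrum)
    fix x assume "x \<in> real_spectrum A"
    then have "convex_on {0<..} (\<lambda>t. s * tsallis_ln t x)"
      using convex_on_tsallis_ln pos sign by blast
    from convex_onD[OF this \<open>0 \<le> t\<close> \<open>t \<le> 1\<close>, of a b]
    show "0 \<le> ?h x"
      using \<open>0 < a\<close> \<open>0 < b\<close> by (simp add: algebra_simps)
  qed
  then show ?thesis
    unfolding cfc_lincomb[OF sa g continuous_on_tsallis_ln_spectrum]
      cfc_lincomb[OF sa continuous_on_tsallis_ln_spectrum continuous_on_tsallis_ln_spectrum]
    by (simp add: blinfun.add_left blinfun.diff_left blinfun.minus_left blinfun.scaleR_left
        rip_add_left rip_diff_left rip.minus_left rip_scaleR_left algebra_simps)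
qed

end

lemma tsallis_entropy_convex:
  fixes A B :: "'a::chilbert_space \<Rightarrow>\<^sub>L 'a"
  assumes A: "selfadjoint_op A" "strictly_positive_op A"
    and B: "selfadjoint_op B" "strictly_positive_op B"
    and le: "\<And>x. s * rip (A x) x \<le> s * rip (B x) x" and s: "s = 1 \<or> s = - 1"
    and ab: "0 < a" "0 < b" "0 \<le> t" "t \<le> 1"
  defines "T \<equiv> tsallis_entropy ((1 - t) * a + t * b) A B"
  defines "U \<equiv> (1 - t) *\<^sub>R tsallis_entropy a A B + t *\<^sub>R tsallis_entropy b A B"
  shows "selfadjoint_op T" "selfadjoint_op U" "s * rip (T y) y \<le> s * rip (U y) y"
proof -
  obtain \<alpha> where \<alpha>: "\<alpha> > 0" "\<And>x. \<alpha> * (norm x)\<^sup>2 \<le> rip (A x) x"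
    using strictly_positive_imp_coercive[OF A] by blast
  obtain \<beta> where \<beta>: "\<beta> > 0" "\<And>x. \<beta> * (norm x)\<^sup>2 \<le> rip (B x) x"
    using strictly_positive_imp_coercive[OF B] by blast
  have posA: "0 < x" if "x \<in> real_spectrum A" for x
    using real_spectrum_ge[OF A(1) \<alpha>(2) that] \<alpha>(1) by simp
  note powr_add = powr_op_add[OF A(1) posA]
  define R where "R = powr_op A (1/2)"
  define Q where "Q = powr_op A (-1/2)"
  define X where "X = Q o\<^sub>L B o\<^sub>L Q"
  have R: "selfadjoint_op R" and Q: "selfadjoint_op Q"
    unfolding R_def Q_def by (blast intro: selfadjoint_powr_op[OF A(1) posA])+
  have RQ: "R (Q x) = x" for x
    using powr_add[of "1/2" "-1/2"] powr_op_0[OF A(1) posA] unfolding R_def Q_def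
    by (metis add.right_inverse blinfun_apply_blinfun_compose blinfun_apply_id_blinfun id_apply
        minus_divide_left)
  have RR: "R (R x) = A x" for x
    using powr_add[of "1/2" "1/2"] powr_op_1[OF A(1) posA] unfolding R_def
    by (metis blinfun_apply_blinfun_compose field_sum_of_halves)
  \<comment> \<open>Evaluated at \<open>Q x\<close>, the form of \<open>A\<close> becomes the
    squared norm and that of \<open>B\<close> becomes the form of \<open>X\<close>; thus comparing
    \<open>A\<close> with \<open>B\<close> compares \<open>X\<close> with the identity.\<close>
  have formA: "rip (A (Q x)) (Q x) = (norm x)\<^sup>2" for x
    by (simp add: RR[symmetric] RQ selfadjoint_rip[OF R] rip_self)
  have formX: "rip (X x) x = rip (B (Q x)) (Q x)" for x
    by (simp add: X_def selfadjoint_rip[OF Q])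
  have saX: "selfadjoint_op X"
    unfolding X_def by (rule selfadjoint_conjugate[OF Q B(1)])
  \<comment> \<open>From \<open>x = R (Q x)\<close>, the squared norm of \<open>x\<close> is at most
    \<open>(norm R)\<^sup>2 + 1\<close> times that of \<open>Q x\<close>; this turns the lower bound
    \<beta> of \<open>B\<close> into the lower bound \<gamma> of \<open>X\<close>.\<close>
  define \<gamma> where "\<gamma> = \<beta> / ((norm R)\<^sup>2 + 1)"
  have n: "(norm R)\<^sup>2 + 1 > 0" by (rule add_nonneg_pos) auto
  have "\<gamma> > 0" unfolding \<gamma>_def using \<beta>(1) n by simp
  have "\<gamma> * (norm x)\<^sup>2 \<le> rip (X x) x" for x
  proof -
    have "(norm x)\<^sup>2 \<le> (norm R * norm (Q x))\<^sup>2"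
      using norm_blinfun[of R "Q x"] by (intro power_mono) (simp_all add: RQ)
    also have "\<dots> \<le> ((norm R)\<^sup>2 + 1) * (norm (Q x))\<^sup>2"
      unfolding power_mult_distrib by (intro mult_right_mono) auto
    finally have "\<gamma> * (norm x)\<^sup>2 \<le> \<gamma> * (((norm R)\<^sup>2 + 1) * (norm (Q x))\<^sup>2)"
      by (rule mult_left_mono) (use \<open>\<gamma> > 0\<close> in simp)
    also have "\<dots> = \<beta> * (norm (Q x))\<^sup>2"
      unfolding \<gamma>_def using n by simp
    finally have "\<gamma> * (norm x)\<^sup>2 \<le> \<beta> * (norm (Q x))\<^sup>2" .
    then show ?thesis using \<beta>(2)[of "Q x"] by (simp add: formX)
  qed
  then have posX: "0 < x" if "x \<in> real_spectrum X" for x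
    using real_spectrum_ge[OF saX _ that, of \<gamma>] \<open>\<gamma> > 0\<close> by fastforce
  have sign: "0 \<le> s * ln x" if "x \<in> real_spectrum X" for x
    using s
  proof
    assume "s = 1"
    then have "1 \<le> x"
      using real_spectrum_ge[OF saX _ that, of 1] le[of "Q y" for y] by (simp add: formX formA)
    with \<open>s = 1\<close> show ?thesis by simp
  next
    assume "s = - 1"
    then have "x \<le> 1"
      using real_spectrum_le[OF saX _ that, of 1] le[of "Q y" for y] by (simp add: formX formA)
    with \<open>s = - 1\<close> posX[OF that] show ?thesis by simp
  qed
  have ent: "tsallis_entropy r A B = R o\<^sub>L cfc (tsallis_ln r) X o\<^sub>L R" for r
    by (simp add: tsallis_entropy_def R_def Q_def X_def)
  have sa_ent: "selfadjoint_op (tsallis_entropy r A B)" for r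
    unfolding ent
    by (intro selfadjoint_conjugate R selfadjoint_cfc saX continuous_on_tsallis_ln_spectrum posX)
  show "selfadjoint_op T" unfolding T_def by (rule sa_ent)
  show "selfadjoint_op U" unfolding U_def
    by (intro selfadjoint_add selfadjoint_scaleR sa_ent)
  \<comment> \<open>Moving the outer \<open>R\<close> across the inner product reduces the entropy
    inequality at \<open>y\<close> to the functional calculus of \<open>X\<close> at
    \<open>R y\<close>.\<close>
  have form: "rip (tsallis_entropy r A B y) y = rip (cfc (tsallis_ln r) X (R y)) (R y)" for r
    by (simp add: ent selfadjoint_rip[OF R])
  show "s * rip (T y) y \<le> s * rip (U y) y"
    using cfc_tsallis_ln_convex[OF saX posX sign ab, of "R y"]
    by (simp add: T_def U_def form blinfun.add_left blinfun.scaleR_left rip_add_left rip_scaleR_left)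
qed

theorem proposition2p1:
  fixes A B :: "'a::chilbert_space \<Rightarrow>\<^sub>L 'a"
  assumes "strictly_positive_op A" and "strictly_positive_op B"
  shows "(A \<le>\<^sub>o\<^sub>p B \<longrightarrow>
           (\<forall>a b t. 0 < a \<and> a \<le> 1 \<and> 0 < b \<and> b \<le> 1 \<and> 0 \<le> t \<and> t \<le> 1 \<longrightarrow>
             tsallis_entropy ((1 - t) * a + t * b) A B \<le>\<^sub>o\<^sub>p
               (1 - t) *\<^sub>R tsallis_entropy a A B + t *\<^sub>R tsallis_entropy b A B)) \<and>
         (B \<le>\<^sub>o\<^sub>p A \<longrightarrow>
           (\<forall>a b t. 0 < a \<and> a \<le> 1 \<and> 0 < b \<and> b \<le> 1 \<and> 0 \<le> t \<and> t \<le> 1 \<longrightarrow>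
             (1 - t) *\<^sub>R tsallis_entropy a A B + t *\<^sub>R tsallis_entropy b A B \<le>\<^sub>o\<^sub>p
               tsallis_entropy ((1 - t) * a + t * b) A B))"
proof (intro conjI impI allI)
  fix a b t :: real
  assume AB: "A \<le>\<^sub>o\<^sub>p B" and "0 < a \<and> a \<le> 1 \<and> 0 < b \<and> b \<le> 1 \<and> 0 \<le> t \<and> t \<le> 1"
  then have ab: "0 < a" "0 < b" "0 \<le> t" "t \<le> 1" by auto
  from AB have sa: "selfadjoint_op A" "selfadjoint_op B" by (simp_all add: le_op_def)
  then have "1 * rip (A x) x \<le> 1 * rip (B x) x" for x using AB le_op_iff[OF sa] by simp
  note conv = tsallis_entropy_convex[OF sa(1) assms(1) sa(2) assms(2) this _ ab]
  show "tsallis_entropy ((1 - t) * a + t * b) A B \<le>\<^sub>o\<^sub>p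
      (1 - t) *\<^sub>R tsallis_entropy a A B + t *\<^sub>R tsallis_entropy b A B"
    using conv(3) by (subst le_op_iff[OF conv(1,2)]) auto
next
  fix a b t :: real
  assume BA: "B \<le>\<^sub>o\<^sub>p A" and "0 < a \<and> a \<le> 1 \<and> 0 < b \<and> b \<le> 1 \<and> 0 \<le> t \<and> t \<le> 1"
  then have ab: "0 < a" "0 < b" "0 \<le> t" "t \<le> 1" by auto
  from BA have sa: "selfadjoint_op A" "selfadjoint_op B" by (simp_all add: le_op_def)
  \<comment> \<open>Multiplying by -1 casts the reversed order into the same shape, so the same
    lemma applies with \<open>s = - 1\<close>.\<close>
  then have "(- 1) * rip (A x) x \<le> (- 1) * rip (B x) x" for x using BA le_op_iff[OF sa(2,1)] by simp
  note conv = tsallis_entropy_convex[OF sa(1) assms(1) sa(2) assms(2) this _ ab]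
  show "(1 - t) *\<^sub>R tsallis_entropy a A B + t *\<^sub>R tsallis_entropy b A B \<le>\<^sub>o\<^sub>p
      tsallis_entropy ((1 - t) * a + t * b) A B"
    using conv(3) by (subst le_op_iff[OF conv(2,1)]) auto
qed

end
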